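(* Let $p$ be an odd prime and let $x$ be a variable. Then $$\sum_{k=0}^{p-1}\binom{2k}{k}^2\binom{4k}{2k}\bigl(x(1-64x)\bigr)^k\equiv \left(\sum_{k=0}^{p-1}\binom{2k}{k}\binom{4k}{2k}x^k\right)^2\pmod{p^2}.$$
   Context: Here $x$ is an indeterminate: the congruence is between polynomials in $\mathbb{Z}[x]$, i.e. all coefficients of the difference of the two sides are divisible by $p^2$. *)

theory Defs
  imports "HOL-Computational_Algebra.Computational_Algebra"
begin

text \<open>
  Congruence of integer polynomials modulo an integer: every coefficient of the difference is
  divisible by the modulus. (The library's \<open>cong\<close> is not available on \<open>int poly\<close>, which is
  not a Euclidean ring.)
\<close>

definition poly_cong :: "int poly \<Rightarrow> int poly \<Rightarrow> int \<Rightarrow> bool" where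
  "poly_cong f g m \<longleftrightarrow> (\<forall>n. m dvd coeff (f - g) n)"

abbreviation X :: "int poly" where
  "X \<equiv> [:0, 1:]"

end

theory Submission
  imports Defs
begin

text \<open>
  Write \<open>a\<^sub>k\<close> and \<open>b\<^sub>k\<close> for the coefficients on the left and on the right, and
  \<open>u = x (1 - 64 x)\<close>. The full power series satisfy the exact identity
  \<open>(\<Sum>k. a\<^sub>k u\<^sup>k) = (\<Sum>k. b\<^sub>k x\<^sup>k)\<^sup>2\<close>, an instance of Clausen's formula: both sides have constant
  term \<open>1\<close> and solve the third-order equation \<open>(u ((u H')' - 24 H))' = 24 u H'\<close>, whose
  power series solutions are determined by their constant term (\<open>clausen_identity\<close>). Hence the two polynomials
  have the same coefficient of \<open>x\<^sup>n\<close> for \<open>n < p\<close>, where the truncation is not felt.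

  For \<open>n \<ge> p\<close> both coefficients vanish modulo \<open>p\<^sup>2\<close>. On the left, \<open>u\<^sup>k\<close> contributes to \<open>x\<^sup>n\<close> only
  if \<open>n \<le> 2 k\<close>, and then \<open>p\<close> divides \<open>2 k choose k\<close>, so \<open>p\<^sup>2\<close> divides \<open>a\<^sub>k\<close>. On the right,
  \<open>p\<^sup>2\<close> divides \<open>b\<^sub>i b\<^sub>j\<close> whenever \<open>i, j < p \<le> i + j\<close> (\<open>prime_square_dvd_b_coeff_mult\<close>).
\<close>

section \<open>Central binomial coefficients\<close>

lemma central_binomial_rec:
  "Suc k * ((2 * Suc k) choose Suc k) = 2 * (2 * k + 1) * ((2 * k) choose k)"
proof -
  have fct: "fact (2 * Suc k) = ((2 * Suc k) choose Suc k) * (Suc k * fact k) * (Suc k * fact k)"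
    using binomial_fact_lemma[of "Suc k" "2 * Suc k"] by (simp add: algebra_simps)
  have fct': "fact (2 * k) = ((2 * k) choose k) * fact k * (fact k :: nat)"
    using binomial_fact_lemma[of k "2 * k"] by (simp add: algebra_simps)
  have "fact (2 * Suc k) = (2 * Suc k) * (2 * k + 1) * (fact (2 * k) :: nat)"
    by (simp add: algebra_simps)
  then have "(Suc k * fact k * fact k) * (Suc k * ((2 * Suc k) choose Suc k))
      = (Suc k * fact k * fact k) * (2 * (2 * k + 1) * ((2 * k) choose k))"
    unfolding fct fct' by (simp only: ac_simps)
  then show ?thesis
    by (simp only: mult_cancel1) simp
qed

text \<open>
  The coefficients of the polynomial that is squared on the right (\<open>b_coeff\<close>) and of the polynomial
  in \<open>x (1 - 64 x)\<close> on the left (\<open>a_coeff\<close>).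
\<close>

definition b_coeff :: "nat \<Rightarrow> nat" where
  "b_coeff k = ((2 * k) choose k) * ((4 * k) choose (2 * k))"

definition a_coeff :: "nat \<Rightarrow> nat" where
  "a_coeff k = ((2 * k) choose k) ^ 2 * ((4 * k) choose (2 * k))"

lemma a_coeff_eq: "a_coeff k = ((2 * k) choose k) * b_coeff k"
  by (simp add: a_coeff_def b_coeff_def power2_eq_square)

lemma b_coeff_rec: "(k + 1)\<^sup>2 * b_coeff (Suc k) = 4 * (4 * k + 1) * (4 * k + 3) * b_coeff k"
proof -
  define c where "c k = (2 * k) choose k" for k :: nat
  have b: "b_coeff k = c k * c (2 * k)" for k
    by (simp add: b_coeff_def c_def mult.assoc[symmetric])
  have r: "(k + 1) * c (Suc k) = 2 * (2 * k + 1) * c k" for k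
    using central_binomial_rec[of k] by (simp add: c_def)
  have r1: "(2 * k + 1) * c (2 * k + 1) = 2 * (4 * k + 1) * c (2 * k)"
    using r[of "2 * k"] by simp
  have r2: "(2 * k + 2) * c (2 * k + 2) = 2 * (4 * k + 3) * c (2 * k + 1)"
    using r[of "2 * k + 1"] by (simp add: algebra_simps)
  have "(2 * (2 * k + 1)) * ((k + 1)\<^sup>2 * (c (Suc k) * c (2 * k + 2)))
      = ((k + 1) * c (Suc k)) * ((2 * k + 1) * ((2 * k + 2) * c (2 * k + 2)))"
    by (simp add: power2_eq_square algebra_simps)
  also have "\<dots> = (2 * (2 * k + 1) * c k) * (2 * (4 * k + 3) * ((2 * k + 1) * c (2 * k + 1)))"
    unfolding r r2 by (simp only: ac_simps)
  also have "\<dots> = (2 * (2 * k + 1)) * (4 * (4 * k + 1) * (4 * k + 3) * (c k * c (2 * k)))"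
    unfolding r1 by (simp add: algebra_simps)
  finally have "(k + 1)\<^sup>2 * (c (Suc k) * c (2 * k + 2))
      = 4 * (4 * k + 1) * (4 * k + 3) * (c k * c (2 * k))"
    by (simp only: mult_cancel1) simp
  then show ?thesis by (simp add: b)
qed

lemma a_coeff_rec:
  "(k + 1) ^ 3 * a_coeff (Suc k) = 8 * (2 * k + 1) * (4 * k + 1) * (4 * k + 3) * a_coeff k"
proof -
  have "(k + 1) ^ 3 * a_coeff (Suc k)
      = (Suc k * ((2 * Suc k) choose Suc k)) * ((k + 1)\<^sup>2 * b_coeff (Suc k))"
    unfolding a_coeff_eq power2_eq_square power3_eq_cube Suc_eq_plus1 by (simp only: ac_simps)
  also have "\<dots> = 8 * (2 * k + 1) * (4 * k + 1) * (4 * k + 3) * a_coeff k"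
    unfolding central_binomial_rec b_coeff_rec a_coeff_eq by (simp add: algebra_simps)
  finally show ?thesis .
qed

section \<open>The Clausen identity\<close>

text \<open>The series \<open>x (1 - 64 x)\<close>, with derivative \<open>1 - 128 x\<close>.\<close>

definition U :: "int fps" where
  "U = fps_X * (1 - 64 * fps_X)"

lemma U_nth: "U $ n = (if n = 1 then 1 else if n = 2 then -64 else 0)"
  by (auto simp: U_def fps_numeral_nth right_diff_distrib mult.left_commute[of fps_X]
      fps_numeral_fps_const)

lemma U_deriv: "fps_deriv U = 1 - 128 * fps_X"
  by (simp add: U_def algebra_simps)

lemma U_deriv_square: "fps_deriv U * fps_deriv U = 1 - 256 * U"
  unfolding U_deriv by (simp add: U_def algebra_simps)

lemma U_nth_0 [simp]: "U $ 0 = 0"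
  by (simp add: U_nth)

lemma U_mult_nth_Suc: "(U * f) $ Suc n = f $ n - 64 * (if n = 0 then 0 else f $ (n - 1))"
proof -
  have "U * f = fps_X * (f - 64 * (fps_X * f))"
    by (simp add: U_def algebra_simps)
  then show ?thesis by (simp add: fps_numeral_fps_const)
qed

lemma deriv_U_mult_nth:
  "fps_deriv (U * f) $ n = of_nat (n + 1) * (f $ n - 64 * (if n = 0 then 0 else f $ (n - 1)))"
  unfolding fps_deriv_nth by (simp add: U_mult_nth_Suc)

text \<open>
  The third-order operator that annihilates both sides of the Clausen identity. It is the symmetric
  square of the operator \<open>y \<mapsto> (U y')' - 12 y\<close>: it kills the products of any two solutions of the latter.
\<close>

definition clausen_op :: "int fps \<Rightarrow> int fps" where
  "clausen_op H = fps_deriv (U * (fps_deriv (U * fps_deriv H) - 24 * H)) - 24 * (U * fps_deriv H)"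

lemma clausen_op_diff: "clausen_op (H - K) = clausen_op H - clausen_op K"
  by (simp add: clausen_op_def algebra_simps)

text \<open>
  As \<open>U = x + O(x\<^sup>2)\<close>, the only exponent of \<open>clausen_op\<close> at the origin is \<open>0\<close>, so a power series
  solution is determined by its constant term.
\<close>

lemma clausen_op_unique:
  assumes "clausen_op H = 0" "H $ 0 = 0"
  shows "H = 0"
proof -
  have "H $ n = 0" for n
  proof (induction n rule: less_induct)
    case (less n)
    show ?case
    proof (cases n)
      case 0
      then show ?thesis using assms by simp
    next
      case (Suc m)
      \<comment> \<open>the coefficient of \<open>x\<^sup>m\<close> in \<open>clausen_op H\<close> is \<open>(m + 1)\<^sup>3 H\<^bsub>m + 1\<^esub>\<close> plus lower coefficients of \<open>H\<close>\<close>
      have low: "H $ i = 0" if "i \<le> m" for i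
        using less Suc that by simp
      have V: "(U * fps_deriv H) $ i = 0" if "i \<le> m" for i
        using that low by (cases i) (auto simp: U_mult_nth_Suc)
      have K: "(fps_deriv (U * fps_deriv H) - 24 * H) $ i = 0" if "i < m" for i
        using that low V[of "Suc i"] by (simp add: fps_numeral_fps_const del: fps_deriv_mult)
      have "(fps_deriv (U * fps_deriv H) - 24 * H) $ m = of_nat (Suc m) * (of_nat (Suc m) * H $ Suc m)"
        using low unfolding fps_sub_nth deriv_U_mult_nth by (simp add: fps_numeral_fps_const)
      then have "clausen_op H $ m = of_nat (Suc m) * (of_nat (Suc m) * (of_nat (Suc m) * H $ Suc m))"
        using V[of m] K[of "m - 1"]
        unfolding clausen_op_def fps_sub_nth[of "fps_deriv _"] deriv_U_mult_nth[of "_ - _"]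
        by (simp add: fps_numeral_fps_const del: fps_deriv_mult fps_sub_nth fps_deriv_nth)
      then show ?thesis using assms Suc by simp
    qed
  qed
  then show ?thesis by (simp add: fps_eq_iff)
qed

text \<open>The full generating series of the two coefficient sequences.\<close>

definition G :: "int fps" where "G = Abs_fps (\<lambda>k. int (b_coeff k))"
definition F :: "int fps" where "F = Abs_fps (\<lambda>k. int (a_coeff k))"

lemma G_ode: "fps_deriv (U * fps_deriv G) = 12 * G"
proof (rule fps_ext)
  fix n
  have "int ((n + 1)\<^sup>2 * b_coeff (Suc n)) = int (4 * (4 * n + 1) * (4 * n + 3) * b_coeff n)"
    unfolding b_coeff_rec ..
  then show "fps_deriv (U * fps_deriv G) $ n = (12 * G) $ n"
    unfolding deriv_U_mult_nth
    by (cases n) (simp_all add: G_def fps_numeral_fps_const power2_eq_square algebra_simps)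
qed

text \<open>
  With \<open>H = G\<^sup>2\<close> and \<open>V = U G'\<close>, so that \<open>V' = 12 G\<close>, one gets \<open>U H' = 2 G V\<close>, then
  \<open>(U H')' - 24 H = 2 G' V\<close>, and \<open>U\<close> times this is \<open>2 V\<^sup>2\<close>, whose derivative is \<open>48 G V = 24 U H'\<close>.
\<close>

lemma clausen_op_square: "clausen_op (G\<^sup>2) = 0"
proof -
  let ?V = "U * fps_deriv G"
  have H: "fps_deriv (G\<^sup>2) = 2 * G * fps_deriv G"
    by (simp add: power2_eq_square)
  have "fps_deriv (U * fps_deriv (G\<^sup>2)) = fps_deriv (2 * (G * ?V))"
    unfolding H by (simp add: algebra_simps)
  also have "\<dots> = 2 * (G * fps_deriv ?V + fps_deriv G * ?V)"
    by (simp only: fps_deriv_mult) (simp add: algebra_simps)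
  also have "\<dots> = 24 * G\<^sup>2 + 2 * (fps_deriv G * ?V)"
    unfolding G_ode by (simp add: power2_eq_square algebra_simps)
  finally have "U * (fps_deriv (U * fps_deriv (G\<^sup>2)) - 24 * G\<^sup>2) = 2 * (?V * ?V)"
    by (simp add: algebra_simps)
  then have "fps_deriv (U * (fps_deriv (U * fps_deriv (G\<^sup>2)) - 24 * G\<^sup>2))
      = fps_deriv (2 * (?V * ?V))" by (simp only:)
  also have "\<dots> = 4 * (?V * fps_deriv ?V)"
    by (simp only: fps_deriv_mult) (simp add: algebra_simps)
  also have "\<dots> = 24 * (U * fps_deriv (G\<^sup>2))"
    unfolding G_ode H by (simp add: algebra_simps)
  finally show ?thesis by (simp add: clausen_op_def)
qed

text \<open>
  The recurrence of the \<open>a\<^sub>k\<close>, with \<open>A = x F'\<close>, in the shape in which \<open>clausen_op\<close> acts on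
  \<open>F oo U\<close> after the change of variable \<open>x \<mapsto> U\<close>.
\<close>

lemma F_ode:
  defines "A \<equiv> fps_X * fps_deriv F"
  shows "fps_deriv (fps_X * ((1 - 256 * fps_X) * fps_deriv A - 128 * A - 24 * F)) = 24 * A"
proof (rule fps_ext)
  fix n
  have "int ((n + 1) ^ 3 * a_coeff (Suc n))
      = int (8 * (2 * n + 1) * (4 * n + 1) * (4 * n + 3) * a_coeff n)"
    unfolding a_coeff_rec ..
  moreover have A: "A $ k = int k * int (a_coeff k)" for k
    by (cases k) (simp_all add: A_def F_def)
  moreover have "(fps_X * fps_deriv A) $ n = int n * A $ n"
    by (cases n) simp_all
  then have "((1 - 256 * fps_X) * fps_deriv A - 128 * A - 24 * F) $ n
      = int (n + 1) * A $ (n + 1) - 256 * (int n * A $ n) - 128 * A $ n - 24 * int (a_coeff n)"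
    by (simp add: F_def fps_numeral_fps_const left_diff_distrib mult.assoc)
  moreover have "fps_deriv (fps_X * f) $ n = int (n + 1) * f $ n" for f :: "int fps"
    unfolding fps_deriv_nth by simp
  ultimately show "fps_deriv (fps_X * ((1 - 256 * fps_X) * fps_deriv A - 128 * A - 24 * F)) $ n
      = (24 * A) $ n"
    by (simp only:) (simp add: A fps_numeral_fps_const power3_eq_cube algebra_simps)
qed

text \<open>
  The chain rule turns \<open>d/dx\<close> into \<open>U' d/dU\<close>; as \<open>U'\<^sup>2 = 1 - 256 U\<close> and \<open>U'' = -128\<close> are polynomials
  in \<open>U\<close>, the equation for \<open>F oo U\<close> becomes \<open>U'\<close> times an equation for \<open>F\<close> composed with \<open>U\<close>.
\<close>

lemma clausen_op_compose: "clausen_op (F oo U) = 0"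
proof -
  define A where "A = fps_X * fps_deriv F"
  define B where "B = (1 - 256 * fps_X) * fps_deriv A - 128 * A - 24 * F"
  let ?D = "fps_deriv U"
  note U0 = U_nth_0
  note dist = fps_compose_mult_distrib[OF U0] fps_compose_deriv[OF U0]
    fps_compose_sub_distrib fps_compose_add_distrib
  have X: "fps_X oo U = U" by (simp add: U0)
  have num: "numeral w oo U = numeral w" for w
    by (simp add: fps_numeral_fps_const)
  have S: "U * fps_deriv (F oo U) = (A oo U) * ?D"
    unfolding A_def by (simp add: dist X mult.assoc)
  have "fps_deriv ((A oo U) * ?D) = (fps_deriv A oo U) * (?D * ?D) - 128 * (A oo U)"
    by (simp add: dist) (simp add: U_deriv algebra_simps)
  also have "\<dots> - 24 * (F oo U) = B oo U"
    unfolding B_def U_deriv_square by (simp add: dist X num algebra_simps)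
  finally have "U * (fps_deriv (U * fps_deriv (F oo U)) - 24 * (F oo U)) = (fps_X * B) oo U"
    unfolding S by (simp add: dist X)
  then have "fps_deriv (U * (fps_deriv (U * fps_deriv (F oo U)) - 24 * (F oo U)))
      = (fps_deriv (fps_X * B) oo U) * ?D"
    by (simp only: fps_compose_deriv[OF U0])
  also have "\<dots> = 24 * ((A oo U) * ?D)"
    using F_ode by (simp add: A_def[symmetric] B_def[symmetric] dist num mult.assoc)
  finally show ?thesis by (simp add: clausen_op_def S)
qed

theorem clausen_identity: "F oo U = G\<^sup>2"
proof -
  have "(F oo U) - G\<^sup>2 = 0"
  proof (rule clausen_op_unique)
    show "clausen_op ((F oo U) - G\<^sup>2) = 0"
      by (simp add: clausen_op_diff clausen_op_square clausen_op_compose)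
    show "((F oo U) - G\<^sup>2) $ 0 = 0"
      by (simp add: F_def G_def a_coeff_def b_coeff_def power2_eq_square)
  qed
  then show ?thesis by simp
qed

section \<open>Divisibility by the prime\<close>

lemma prime_dvd_central_binomial:
  assumes "prime p" "k < p" "p \<le> 2 * k"
  shows "p dvd (2 * k) choose k"
proof -
  have "p dvd fact k * fact (2 * k - k) * ((2 * k) choose k)"
    using assms by (subst binomial_fact_lemma) (auto simp: prime_dvd_fact_iff)
  then show ?thesis
    using assms by (auto simp: prime_dvd_mult_iff prime_dvd_fact_iff)
qed

lemma prime_square_not_dvd_fact:
  assumes "prime (p :: nat)" "m < 2 * p"
  shows "\<not> p\<^sup>2 dvd fact m"
  using assms(2)
proof (induction m)
  case 0
  then show ?case using assms(1) by auto
next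
  case (Suc m)
  show ?case
  proof (cases "Suc m = p")
    case True
    then have "fact (Suc m) = p * (fact m :: nat)"
      using fact_Suc[of m, where 'a = nat] by simp
    then have "p\<^sup>2 dvd fact (Suc m) \<longleftrightarrow> p dvd fact m"
      using assms(1) by (simp add: power2_eq_square del: fact_Suc)
    then show ?thesis using assms(1) True prime_dvd_fact_iff[of p m] by simp
  next
    case False
    have "\<not> p dvd Suc m"
    proof
      assume "p dvd Suc m"
      then obtain c where "Suc m = p * c" ..
      moreover from this False have "c \<ge> 2" by (cases "c = 0 \<or> c = 1") auto
      then have "p * 2 \<le> p * c" by simp
      ultimately show False using Suc.prems by simp
    qed
    then have "coprime (p\<^sup>2) (Suc m)"
      using assms(1) by (simp add: prime_imp_coprime)
    then show ?thesis using Suc by (simp add: coprime_dvd_mult_right_iff del: mult_Suc)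
  qed
qed

text \<open>Here \<open>p\<^sup>3\<close> divides \<open>(2 m)!\<close>, while \<open>m!\<close> has only one factor \<open>p\<close>.\<close>

lemma prime_dvd_central_binomial':
  assumes "prime p" "m < 2 * p" "3 * p \<le> 2 * m"
  shows "p dvd (2 * m) choose m"
proof -
  have "p \<le> m" using assms by simp
  then have "p dvd fact m" using assms(1) by (simp add: prime_dvd_fact_iff)
  then obtain w where w: "fact m = p * w" ..
  have nw: "\<not> p dvd w"
    using prime_square_not_dvd_fact[OF assms(1,2)] unfolding w
    by (auto simp: power2_eq_square)
  have "p dvd fact p" using assms(1) by (simp add: prime_dvd_fact_iff)
  moreover have "fact p * fact p * fact p dvd (fact (p + p + p) :: nat)"
    using fact_fact_dvd_fact[of p p, where 'a = nat] fact_fact_dvd_fact[of "p + p" p, where 'a = nat]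
    by (meson dvd_trans mult_dvd_mono dvd_refl)
  moreover have "fact (p + p + p) dvd (fact (2 * m) :: nat)"
    using assms by (intro fact_dvd) simp
  ultimately have "p * p * p dvd fact (2 * m)"
    by (meson dvd_trans mult_dvd_mono)
  also have "fact (2 * m) = (p * p) * (w * w * ((2 * m) choose m))"
    using binomial_fact_lemma[of m "2 * m"] by (simp add: w algebra_simps)
  finally have "p dvd w * w * ((2 * m) choose m)"
    using assms(1) by auto
  then show ?thesis using nw assms(1) by (auto simp: prime_dvd_mult_iff)
qed

lemma prime_dvd_b_coeff:
  assumes "prime p" "k < p" "p \<le> 4 * k"
  shows "p dvd b_coeff k"
proof (cases "p \<le> 2 * k")
  case True
  then show ?thesis using prime_dvd_central_binomial[of p k] assms by (simp add: b_coeff_def)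
next
  case False
  then show ?thesis using prime_dvd_central_binomial[of p "2 * k"] assms by (simp add: b_coeff_def)
qed

lemma prime_square_dvd_b_coeff:
  assumes "prime p" "k < p" "3 * p \<le> 4 * k"
  shows "p\<^sup>2 dvd b_coeff k"
  using prime_dvd_central_binomial[of p k] prime_dvd_central_binomial'[of p "2 * k"] assms
  by (simp add: b_coeff_def power2_eq_square mult_dvd_mono)

text \<open>
  If \<open>4 i < p\<close> then \<open>4 j > 3 p\<close>, and \<open>p\<^sup>2\<close> already divides \<open>b\<^sub>j\<close>; likewise with \<open>i\<close> and \<open>j\<close>
  exchanged. Otherwise \<open>p\<close> divides both factors.
\<close>

lemma prime_square_dvd_b_coeff_mult:
  assumes "prime p" "i < p" "j < p" "p \<le> i + j"
  shows "p\<^sup>2 dvd b_coeff i * b_coeff j"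
proof -
  consider "3 * p \<le> 4 * i" | "3 * p \<le> 4 * j" | "p \<le> 4 * i" "p \<le> 4 * j"
    using assms(4) by linarith
  then show ?thesis
  proof cases
    case 3
    then show ?thesis using prime_dvd_b_coeff assms
      by (simp add: power2_eq_square mult_dvd_mono)
  qed (use prime_square_dvd_b_coeff assms in auto)
qed

lemma prime_square_dvd_a_coeff:
  assumes "prime p" "k < p" "p \<le> 2 * k"
  shows "p\<^sup>2 dvd a_coeff k"
  using prime_dvd_central_binomial[OF assms] by (simp add: a_coeff_def)

section \<open>The congruence\<close>

lemma u_poly: "X * (1 - 64 * X) = [:0, 1, -64:]"
  by (simp add: numeral_poly one_pCons)

lemma fps_of_poly_u: "fps_of_poly (X * (1 - 64 * X)) = U"
  unfolding u_poly by (rule fps_ext) (auto simp: U_nth coeff_pCons split: nat.split)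

lemma coeff_u_power: "coeff ((X * (1 - 64 * X)) ^ k) n = (U ^ k) $ n"
  unfolding fps_of_poly_u[symmetric] fps_of_poly_power[symmetric] by simp

text \<open>The power \<open>U\<^sup>k\<close> only involves \<open>x\<^sup>n\<close> for \<open>k \<le> n \<le> 2 k\<close>.\<close>

lemma U_power_nth_eq_0:
  assumes "n < k \<or> 2 * k < n"
  shows "(U ^ k) $ n = 0"
  using assms
proof
  assume "n < k"
  then show ?thesis by (intro startsby_zero_power_prefix[rule_format]) (auto simp: U_nth)
next
  assume "2 * k < n"
  moreover have "degree ((X * (1 - 64 * X)) ^ k) \<le> 2 * k"
    unfolding u_poly by (rule order_trans[OF degree_power_le]) simp
  ultimately show ?thesis unfolding coeff_u_power[symmetric] by (intro coeff_eq_0) simp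
qed

lemma coeff_b_poly: "coeff (\<Sum>k = 0..m. of_nat (b_coeff k) * X ^ k) n
    = (if n \<le> m then int (b_coeff n) else 0)"
proof -
  have "of_nat (b_coeff k) * X ^ k = monom (int (b_coeff k)) k" for k
    by (simp add: of_nat_poly monom_altdef)
  then show ?thesis by (simp add: coeff_sum)
qed

theorem theorem2p1:
  fixes p :: nat
  assumes "prime p" and "odd p"
  shows "poly_cong
    (\<Sum>k = 0..p - 1. of_nat (((2 * k) choose k) ^ 2 * ((4 * k) choose (2 * k))) * (X * (1 - 64 * X)) ^ k)
    ((\<Sum>k = 0..p - 1. of_nat (((2 * k) choose k) * ((4 * k) choose (2 * k))) * X ^ k) ^ 2)
    (int p ^ 2)"
proof -
  let ?L = "\<Sum>k = 0..p - 1. of_nat (a_coeff k) * (X * (1 - 64 * X)) ^ k"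
  let ?R = "\<Sum>k = 0..p - 1. of_nat (b_coeff k) * X ^ k"
  have p: "p > 0" using assms(1) by (rule prime_gt_0_nat)
  have coeff_of_nat_mult: "coeff (of_nat c * f) n = int c * coeff f n" for c n and f :: "int poly"
    by (simp add: of_nat_poly)
  have L: "coeff ?L n = (\<Sum>k = 0..p - 1. int (a_coeff k) * (U ^ k) $ n)" for n
    by (simp only: coeff_sum coeff_of_nat_mult coeff_u_power)
  have R: "coeff (?R\<^sup>2) n = (\<Sum>i\<le>n. coeff ?R i * coeff ?R (n - i))" for n
    by (simp only: power2_eq_square coeff_mult)
  have "int p ^ 2 dvd coeff (?L - ?R\<^sup>2) n" for n
  proof (cases "n < p")
    case True
    have "coeff ?L n = (F oo U) $ n"
      unfolding L fps_compose_nth using True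
      by (intro sum.mono_neutral_cong_right) (auto simp: F_def U_power_nth_eq_0)
    also have "\<dots> = coeff (?R\<^sup>2) n"
      unfolding clausen_identity R unfolding power2_eq_square fps_mult_nth using True
      by (intro sum.cong) (auto simp: coeff_b_poly G_def)
    finally show ?thesis by simp
  next
    case False
    \<comment> \<open>each term vanishes on its own, either because of \<open>a\<^sub>k\<close> or because \<open>2 k < n\<close>\<close>
    have "int p ^ 2 dvd int (a_coeff k) * (U ^ k) $ n" if "k \<le> p - 1" for k
    proof (cases "p \<le> 2 * k")
      case True
      then have "int (p\<^sup>2) dvd int (a_coeff k)"
        using prime_square_dvd_a_coeff[of p k] assms that p by (subst int_dvd_int_iff) simp
      then show ?thesis by simp
    next
      case 2: False
      then show ?thesis using False U_power_nth_eq_0[of n k] by simp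
    qed
    then have "int p ^ 2 dvd coeff ?L n"
      unfolding L by (intro dvd_sum) simp
    moreover have "int p ^ 2 dvd coeff ?R i * coeff ?R (n - i)" if "i \<le> n" for i
    proof (cases "i \<le> p - 1 \<and> n - i \<le> p - 1")
      case True
      then have "int (p\<^sup>2) dvd int (b_coeff i * b_coeff (n - i))"
        using prime_square_dvd_b_coeff_mult[of p i "n - i"] assms that p False
        by (subst int_dvd_int_iff) auto
      then show ?thesis using True by (simp add: coeff_b_poly)
    qed (auto simp: coeff_b_poly)
    then have "int p ^ 2 dvd coeff (?R\<^sup>2) n"
      unfolding R by (intro dvd_sum) simp
    ultimately show ?thesis by simp
  qed
  then show ?thesis
    unfolding poly_cong_def a_coeff_def b_coeff_def by blast
qed

end
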